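(* Let $G=G_1\ast_F G_2$ be a virtually cyclic group of Type II, let $H$ be a group, and let $\varphi\colon G_1\ast_F G_2\to H$ be a homomorphism such that the restriction of $\varphi$ to each $G_i$, $i=1,2$, is injective. Then $\varphi$ is injective if and only if $\varphi(G)$ is infinite.
   Context: A group is virtually cyclic if it contains a cyclic subgroup of finite index. An infinite virtually cyclic group $G$ is said to be of Type II if it is of the form of an amalgamated product $G=G_1\ast_F G_2$, where $F$ is a finite group that is a subgroup of index $2$ in each of $G_1$ and $G_2$ (i.e. $[G_i:F]=2$ for $i=1,2$). The factors $G_1,G_2$ are regarded as subgroups of $G$. *)

theory Defs
  imports "HOL-Algebra.Elementary_Groups"
begin

text \<open>
  The amalgamated product of two groups \<open>A\<close> and \<open>B\<close> along homomorphisms \<open>f: C \<rightarrow> A\<close> and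
  \<open>g: C \<rightarrow> B\<close>: words over the disjoint union of the carriers, modulo the least congruence that
  multiplies adjacent letters of the same factor, deletes the units, and identifies \<open>f c\<close>
  with \<open>g c\<close>.  Formal inverses of letters are not needed, since the factors are groups.
\<close>

definition amalg_words ::
  "('a, 'm) monoid_scheme \<Rightarrow> ('b, 'n) monoid_scheme \<Rightarrow> ('a + 'b) list set"
  where "amalg_words A B = lists (carrier A <+> carrier B)"

inductive amalg_cong ::
  "('a, 'm) monoid_scheme \<Rightarrow> ('b, 'n) monoid_scheme \<Rightarrow> ('c, 'k) monoid_scheme
    \<Rightarrow> ('c \<Rightarrow> 'a) \<Rightarrow> ('c \<Rightarrow> 'b) \<Rightarrow> ('a + 'b) list \<Rightarrow> ('a + 'b) list \<Rightarrow> bool"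
  for A B C f g where
  refl: "u \<in> amalg_words A B \<Longrightarrow> amalg_cong A B C f g u u"
| sym: "amalg_cong A B C f g u v \<Longrightarrow> amalg_cong A B C f g v u"
| trans: "amalg_cong A B C f g u v \<Longrightarrow> amalg_cong A B C f g v w \<Longrightarrow> amalg_cong A B C f g u w"
| append: "amalg_cong A B C f g u u' \<Longrightarrow> amalg_cong A B C f g v v'
    \<Longrightarrow> amalg_cong A B C f g (u @ v) (u' @ v')"
| mult_left: "x \<in> carrier A \<Longrightarrow> y \<in> carrier A
    \<Longrightarrow> amalg_cong A B C f g [Inl x, Inl y] [Inl (x \<otimes>\<^bsub>A\<^esub> y)]"
| mult_right: "x \<in> carrier B \<Longrightarrow> y \<in> carrier B
    \<Longrightarrow> amalg_cong A B C f g [Inr x, Inr y] [Inr (x \<otimes>\<^bsub>B\<^esub> y)]"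
| one_left: "amalg_cong A B C f g [Inl \<one>\<^bsub>A\<^esub>] []"
| one_right: "amalg_cong A B C f g [Inr \<one>\<^bsub>B\<^esub>] []"
| amalgamate: "c \<in> carrier C \<Longrightarrow> amalg_cong A B C f g [Inl (f c)] [Inr (g c)]"

definition amalg_class ::
  "('a, 'm) monoid_scheme \<Rightarrow> ('b, 'n) monoid_scheme \<Rightarrow> ('c, 'k) monoid_scheme
    \<Rightarrow> ('c \<Rightarrow> 'a) \<Rightarrow> ('c \<Rightarrow> 'b) \<Rightarrow> ('a + 'b) list \<Rightarrow> ('a + 'b) list set"
  where "amalg_class A B C f g u = {v. amalg_cong A B C f g u v}"

definition amalgamated_product ::
  "('a, 'm) monoid_scheme \<Rightarrow> ('b, 'n) monoid_scheme \<Rightarrow> ('c, 'k) monoid_scheme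
    \<Rightarrow> ('c \<Rightarrow> 'a) \<Rightarrow> ('c \<Rightarrow> 'b) \<Rightarrow> ('a + 'b) list set monoid"
  where "amalgamated_product A B C f g =
    \<lparr>carrier = amalg_class A B C f g ` amalg_words A B,
     mult = (\<lambda>X Y. \<Union>u\<in>X. \<Union>v\<in>Y. amalg_class A B C f g (u @ v)),
     one = amalg_class A B C f g []\<rparr>"

definition amalg_inl ::
  "('a, 'm) monoid_scheme \<Rightarrow> ('b, 'n) monoid_scheme \<Rightarrow> ('c, 'k) monoid_scheme
    \<Rightarrow> ('c \<Rightarrow> 'a) \<Rightarrow> ('c \<Rightarrow> 'b) \<Rightarrow> 'a \<Rightarrow> ('a + 'b) list set"
  where "amalg_inl A B C f g x = amalg_class A B C f g [Inl x]"

definition amalg_inr ::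
  "('a, 'm) monoid_scheme \<Rightarrow> ('b, 'n) monoid_scheme \<Rightarrow> ('c, 'k) monoid_scheme
    \<Rightarrow> ('c \<Rightarrow> 'a) \<Rightarrow> ('c \<Rightarrow> 'b) \<Rightarrow> 'b \<Rightarrow> ('a + 'b) list set"
  where "amalg_inr A B C f g y = amalg_class A B C f g [Inr y]"

text \<open>
  \<open>G = G\<^sub>1 *\<^sub>F G\<^sub>2\<close> with the factors regarded as subgroups of \<open>G\<close>: the amalgamated
  product of \<open>G\<^sub>1\<close> and \<open>G\<^sub>2\<close> along the inclusions of \<open>F\<close> is isomorphic to \<open>G\<close> by a map that
  extends the inclusions of \<open>G\<^sub>1\<close> and \<open>G\<^sub>2\<close>.  That \<open>F = G\<^sub>1 \<inter> G\<^sub>2\<close> is a consequence, and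
  is therefore not demanded.
\<close>

definition is_amalgam ::
  "('a, 'm) monoid_scheme \<Rightarrow> 'a set \<Rightarrow> 'a set \<Rightarrow> 'a set \<Rightarrow> bool"
  where "is_amalgam G G1 G2 F \<longleftrightarrow>
    group G \<and> subgroup G1 G \<and> subgroup G2 G \<and> subgroup F G \<and> F \<subseteq> G1 \<and> F \<subseteq> G2 \<and>
    (let A = G\<lparr>carrier := G1\<rparr>; B = G\<lparr>carrier := G2\<rparr>; C = G\<lparr>carrier := F\<rparr>
     in \<exists>\<psi> \<in> iso (amalgamated_product A B C id id) G.
          (\<forall>x\<in>G1. \<psi> (amalg_inl A B C id id x) = x) \<and>
          (\<forall>y\<in>G2. \<psi> (amalg_inr A B C id id y) = y))"

definition virtually_cyclic :: "('a, 'm) monoid_scheme \<Rightarrow> bool"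
  where "virtually_cyclic G \<longleftrightarrow>
    group G \<and>
    (\<exists>C. subgroup C G \<and> cyclic_group (G\<lparr>carrier := C\<rparr>) \<and> finite (rcosets\<^bsub>G\<^esub> C))"

text \<open>
  \<open>G\<close> is an infinite virtually cyclic group of Type II, with decomposition \<open>G = G\<^sub>1 *\<^sub>F G\<^sub>2\<close>.
\<close>

definition type_II ::
  "('a, 'm) monoid_scheme \<Rightarrow> 'a set \<Rightarrow> 'a set \<Rightarrow> 'a set \<Rightarrow> bool"
  where "type_II G G1 G2 F \<longleftrightarrow>
    infinite (carrier G) \<and> virtually_cyclic G \<and>
    is_amalgam G G1 G2 F \<and> finite F \<and>
    card (rcosets\<^bsub>G\<lparr>carrier := G1\<rparr>\<^esub> F) = 2 \<and>
    card (rcosets\<^bsub>G\<lparr>carrier := G2\<rparr>\<^esub> F) = 2"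


subsection \<open>The construction is the pushout of groups\<close>

text \<open>
  Its carrier, multiplication and unit form a group, the canonical maps of the two factors are
  homomorphisms that agree on \<open>C\<close>, and every compatible pair of homomorphisms factors uniquely.
\<close>

context
  fixes A :: "('a, 'm) monoid_scheme" and B :: "('b, 'n) monoid_scheme"
    and C :: "('c, 'k) monoid_scheme" and f g
  assumes A: "group A" and B: "group B" and f: "f \<in> hom C A" and g: "g \<in> hom C B"
begin

lemma Nil_in_amalg_words: "[] \<in> amalg_words A B"
  by (simp add: amalg_words_def)

lemma append_in_amalg_words:
  "u @ v \<in> amalg_words A B \<longleftrightarrow> u \<in> amalg_words A B \<and> v \<in> amalg_words A B"
  by (simp add: amalg_words_def)

lemma amalg_cong_words:
  assumes "amalg_cong A B C f g u v"
  shows "u \<in> amalg_words A B \<and> v \<in> amalg_words A B"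
  using assms
proof (induction rule: amalg_cong.induct)
  case (amalgamate c)
  then show ?case
    using f g by (auto simp: amalg_words_def hom_def)
qed (use A B in \<open>auto simp: amalg_words_def group_def monoid.m_closed monoid.one_closed\<close>)

lemma amalg_class_eq_iff:
  assumes "u \<in> amalg_words A B"
  shows "amalg_class A B C f g u = amalg_class A B C f g v \<longleftrightarrow> amalg_cong A B C f g u v"
proof
  assume "amalg_class A B C f g u = amalg_class A B C f g v"
  moreover have "u \<in> amalg_class A B C f g u"
    using assms by (simp add: amalg_class_def amalg_cong.refl)
  ultimately have "u \<in> amalg_class A B C f g v" by simp
  then show "amalg_cong A B C f g u v"
    by (simp add: amalg_class_def amalg_cong.sym)
next
  assume "amalg_cong A B C f g u v"
  then show "amalg_class A B C f g u = amalg_class A B C f g v"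
    unfolding amalg_class_def by (blast intro: amalg_cong.sym amalg_cong.trans)
qed

lemma amalg_mult_class:
  assumes "u \<in> amalg_words A B" "v \<in> amalg_words A B"
  shows "amalg_class A B C f g u \<otimes>\<^bsub>amalgamated_product A B C f g\<^esub> amalg_class A B C f g v
    = amalg_class A B C f g (u @ v)"
proof -
  have same: "amalg_class A B C f g (u' @ v') = amalg_class A B C f g (u @ v)"
    if "u' \<in> amalg_class A B C f g u" "v' \<in> amalg_class A B C f g v" for u' v'
    using that assms amalg_class_eq_iff[of "u @ v" "u' @ v'"]
    by (simp add: amalg_class_def append_in_amalg_words amalg_cong.append)
  have mem: "u \<in> amalg_class A B C f g u" "v \<in> amalg_class A B C f g v"
    using assms by (simp_all add: amalg_class_def amalg_cong.refl)
  have "(\<Union>u'\<in>amalg_class A B C f g u. \<Union>v'\<in>amalg_class A B C f g v.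
      amalg_class A B C f g (u' @ v')) = amalg_class A B C f g (u @ v)"
  proof (intro equalityI subsetI)
    fix w
    assume "w \<in> (\<Union>u'\<in>amalg_class A B C f g u. \<Union>v'\<in>amalg_class A B C f g v.
      amalg_class A B C f g (u' @ v'))"
    then show "w \<in> amalg_class A B C f g (u @ v)"
      using same by blast
  next
    fix w
    assume "w \<in> amalg_class A B C f g (u @ v)"
    then show "w \<in> (\<Union>u'\<in>amalg_class A B C f g u. \<Union>v'\<in>amalg_class A B C f g v.
      amalg_class A B C f g (u' @ v'))"
      using mem by blast
  qed
  then show ?thesis
    by (simp add: amalgamated_product_def)
qed

lemma amalg_left_inverse:
  assumes "u \<in> amalg_words A B"
  shows "\<exists>v \<in> amalg_words A B. amalg_cong A B C f g (v @ u) []"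
  using assms
proof (induction u)
  case Nil
  then show ?case
    by (intro bexI[of _ "[]"]) (simp_all add: amalg_cong.refl Nil_in_amalg_words)
next
  case (Cons x u)
  then have u: "u \<in> amalg_words A B" and x: "[x] \<in> amalg_words A B"
    by (simp_all add: amalg_words_def)
  obtain v where v: "v \<in> amalg_words A B" "amalg_cong A B C f g (v @ u) []"
    using Cons.IH u by blast
  obtain y where y: "[y] \<in> amalg_words A B" "amalg_cong A B C f g [y, x] []"
  proof (cases x)
    case (Inl a)
    then have a: "a \<in> carrier A" using x by (auto simp: amalg_words_def)
    have "amalg_cong A B C f g [Inl (inv\<^bsub>A\<^esub> a), Inl a] [Inl \<one>\<^bsub>A\<^esub>]"
      using amalg_cong.mult_left[of "inv\<^bsub>A\<^esub> a" A a B C f g] a A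
      by (simp add: group.inv_closed group.l_inv)
    then have "amalg_cong A B C f g [Inl (inv\<^bsub>A\<^esub> a), x] []"
      unfolding Inl by (rule amalg_cong.trans[OF _ amalg_cong.one_left])
    moreover have "[Inl (inv\<^bsub>A\<^esub> a)] \<in> amalg_words A B"
      using a A by (auto simp: amalg_words_def group.inv_closed)
    ultimately show ?thesis by (rule that[rotated])
  next
    case (Inr b)
    then have b: "b \<in> carrier B" using x by (auto simp: amalg_words_def)
    have "amalg_cong A B C f g [Inr (inv\<^bsub>B\<^esub> b), Inr b] [Inr \<one>\<^bsub>B\<^esub>]"
      using amalg_cong.mult_right[of "inv\<^bsub>B\<^esub> b" B b A C f g] b B
      by (simp add: group.inv_closed group.l_inv)
    then have "amalg_cong A B C f g [Inr (inv\<^bsub>B\<^esub> b), x] []"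
      unfolding Inr by (rule amalg_cong.trans[OF _ amalg_cong.one_right])
    moreover have "[Inr (inv\<^bsub>B\<^esub> b)] \<in> amalg_words A B"
      using b B by (auto simp: amalg_words_def group.inv_closed)
    ultimately show ?thesis by (rule that[rotated])
  qed
  have "amalg_cong A B C f g (v @ [y, x] @ u) (v @ [] @ u)"
    using v u y by (intro amalg_cong.append amalg_cong.refl) auto
  then have "amalg_cong A B C f g ((v @ [y]) @ x # u) []"
    using v(2) amalg_cong.trans by fastforce
  moreover have "v @ [y] \<in> amalg_words A B"
    using v y by (simp add: append_in_amalg_words)
  ultimately show ?case by blast
qed

lemma group_amalgamated_product: "group (amalgamated_product A B C f g)"
proof (rule groupI)
  let ?P = "amalgamated_product A B C f g"
  have car: "carrier ?P = amalg_class A B C f g ` amalg_words A B"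
    and one: "\<one>\<^bsub>?P\<^esub> = amalg_class A B C f g []"
    by (simp_all add: amalgamated_product_def)
  show "\<one>\<^bsub>?P\<^esub> \<in> carrier ?P"
    using Nil_in_amalg_words by (simp add: car one)
  show "x \<otimes>\<^bsub>?P\<^esub> y \<in> carrier ?P" if "x \<in> carrier ?P" "y \<in> carrier ?P" for x y
    using that by (auto simp: car amalg_mult_class append_in_amalg_words)
  show "x \<otimes>\<^bsub>?P\<^esub> y \<otimes>\<^bsub>?P\<^esub> z = x \<otimes>\<^bsub>?P\<^esub> (y \<otimes>\<^bsub>?P\<^esub> z)"
    if "x \<in> carrier ?P" "y \<in> carrier ?P" "z \<in> carrier ?P" for x y z
    using that by (auto simp: car amalg_mult_class append_in_amalg_words)
  show "\<one>\<^bsub>?P\<^esub> \<otimes>\<^bsub>?P\<^esub> x = x" if "x \<in> carrier ?P" for x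
    using that by (auto simp: car one amalg_mult_class Nil_in_amalg_words)
  show "\<exists>y\<in>carrier ?P. y \<otimes>\<^bsub>?P\<^esub> x = \<one>\<^bsub>?P\<^esub>" if x: "x \<in> carrier ?P" for x
  proof -
    obtain u where u: "u \<in> amalg_words A B" "x = amalg_class A B C f g u"
      using x unfolding car by blast
    obtain v where v: "v \<in> amalg_words A B" "amalg_cong A B C f g (v @ u) []"
      using amalg_left_inverse u by blast
    then have "amalg_class A B C f g v \<otimes>\<^bsub>?P\<^esub> x = \<one>\<^bsub>?P\<^esub>"
      using u by (simp add: one amalg_mult_class amalg_class_eq_iff append_in_amalg_words)
    then show ?thesis using v by (auto simp: car)
  qed
qed

lemma amalg_inl_hom: "amalg_inl A B C f g \<in> hom A (amalgamated_product A B C f g)"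
proof (rule homI)
  fix x y assume xy: "x \<in> carrier A" "y \<in> carrier A"
  show "amalg_inl A B C f g x \<in> carrier (amalgamated_product A B C f g)"
    using xy by (auto simp: amalg_inl_def amalgamated_product_def amalg_words_def)
  have "amalg_class A B C f g [Inl x, Inl y] = amalg_class A B C f g [Inl (x \<otimes>\<^bsub>A\<^esub> y)]"
    using xy amalg_cong.mult_left by (subst amalg_class_eq_iff) (auto simp: amalg_words_def)
  then show "amalg_inl A B C f g (x \<otimes>\<^bsub>A\<^esub> y)
      = amalg_inl A B C f g x \<otimes>\<^bsub>amalgamated_product A B C f g\<^esub> amalg_inl A B C f g y"
    using xy amalg_mult_class[of "[Inl x]" "[Inl y]"]
    by (simp add: amalg_inl_def amalg_words_def InlI InrI)
qed

lemma amalg_inr_hom: "amalg_inr A B C f g \<in> hom B (amalgamated_product A B C f g)"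
proof (rule homI)
  fix x y assume xy: "x \<in> carrier B" "y \<in> carrier B"
  show "amalg_inr A B C f g x \<in> carrier (amalgamated_product A B C f g)"
    using xy by (auto simp: amalg_inr_def amalgamated_product_def amalg_words_def)
  have "amalg_class A B C f g [Inr x, Inr y] = amalg_class A B C f g [Inr (x \<otimes>\<^bsub>B\<^esub> y)]"
    using xy amalg_cong.mult_right by (subst amalg_class_eq_iff) (auto simp: amalg_words_def)
  then show "amalg_inr A B C f g (x \<otimes>\<^bsub>B\<^esub> y)
      = amalg_inr A B C f g x \<otimes>\<^bsub>amalgamated_product A B C f g\<^esub> amalg_inr A B C f g y"
    using xy amalg_mult_class[of "[Inr x]" "[Inr y]"]
    by (simp add: amalg_inr_def amalg_words_def InlI InrI)
qed

lemma amalg_inl_eq_inr: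
  assumes "c \<in> carrier C"
  shows "amalg_inl A B C f g (f c) = amalg_inr A B C f g (g c)"
proof -
  have "amalg_cong A B C f g [Inl (f c)] [Inr (g c)]"
    using assms by (rule amalg_cong.amalgamate)
  then show ?thesis
    using amalg_cong_words by (simp add: amalg_inl_def amalg_inr_def amalg_class_eq_iff)
qed

lemma amalg_universal_ex:
  fixes H :: "('d, 'l) monoid_scheme"
  assumes H: "group H" and p: "p \<in> hom A H" and q: "q \<in> hom B H"
    and pq: "\<And>c. c \<in> carrier C \<Longrightarrow> p (f c) = q (g c)"
  shows "\<exists>h \<in> hom (amalgamated_product A B C f g) H.
    (\<forall>x\<in>carrier A. h (amalg_inl A B C f g x) = p x) \<and>
    (\<forall>y\<in>carrier B. h (amalg_inr A B C f g y) = q y)"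
proof -
  interpret H: group H by (rule H)
  define e where "e = (\<lambda>u. foldr (\<lambda>x z. case_sum p q x \<otimes>\<^bsub>H\<^esub> z) u \<one>\<^bsub>H\<^esub>)"
  have letter: "case_sum p q x \<in> carrier H" if "x \<in> carrier A <+> carrier B" for x
    using that p q by (auto simp: hom_def)
  have e_closed: "e u \<in> carrier H" if "u \<in> amalg_words A B" for u
    using that by (induction u) (auto simp: e_def amalg_words_def intro!: letter H.m_closed)
  have e_append: "e (u @ v) = e u \<otimes>\<^bsub>H\<^esub> e v" if "u \<in> amalg_words A B" "v \<in> amalg_words A B" for u v
    using that(1)
  proof (induction u)
    case Nil
    then show ?case using e_closed[OF that(2)] by (simp add: e_def)
  next
    case (Cons x u)
    then have "x \<in> carrier A <+> carrier B" "u \<in> amalg_words A B"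
      by (simp_all add: amalg_words_def)
    moreover have "e (x # w) = case_sum p q x \<otimes>\<^bsub>H\<^esub> e w" for w
      by (simp add: e_def)
    ultimately show ?case
      using Cons.IH letter e_closed that(2) by (simp add: H.m_assoc)
  qed
  have e_cong: "e u = e v" if "amalg_cong A B C f g u v" for u v
    using that
  proof (induction rule: amalg_cong.induct)
    case (append u u' v v')
    then show ?case
      using amalg_cong_words e_append by metis
  next
    case (mult_left x y)
    then have "p x \<in> carrier H" "p y \<in> carrier H" "p (x \<otimes>\<^bsub>A\<^esub> y) = p x \<otimes>\<^bsub>H\<^esub> p y"
      using p by (auto simp: hom_def)
    then show ?case by (simp add: e_def)
  next
    case (mult_right x y)
    then have "q x \<in> carrier H" "q y \<in> carrier H" "q (x \<otimes>\<^bsub>B\<^esub> y) = q x \<otimes>\<^bsub>H\<^esub> q y"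
      using q by (auto simp: hom_def)
    then show ?case by (simp add: e_def)
  next
    case one_left
    then show ?case using hom_one[OF p A H] by (simp add: e_def)
  next
    case one_right
    then show ?case using hom_one[OF q B H] by (simp add: e_def)
  qed (use pq in \<open>auto simp: e_def\<close>)
  define h where "h = (\<lambda>X. e (SOME u. u \<in> X))"
  have h_class: "h (amalg_class A B C f g u) = e u" if "u \<in> amalg_words A B" for u
  proof -
    have "u \<in> amalg_class A B C f g u"
      using that by (simp add: amalg_class_def amalg_cong.refl)
    then have "(SOME v. v \<in> amalg_class A B C f g u) \<in> amalg_class A B C f g u"
      by (rule someI)
    then have "amalg_cong A B C f g u (SOME v. v \<in> amalg_class A B C f g u)"
      by (simp add: amalg_class_def)
    then show ?thesis
      unfolding h_def by (rule e_cong[symmetric])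
  qed
  have "h \<in> hom (amalgamated_product A B C f g) H"
  proof (rule homI)
    fix x y
    assume "x \<in> carrier (amalgamated_product A B C f g)"
      "y \<in> carrier (amalgamated_product A B C f g)"
    then obtain u v where uv: "u \<in> amalg_words A B" "x = amalg_class A B C f g u"
      "v \<in> amalg_words A B" "y = amalg_class A B C f g v"
      by (auto simp: amalgamated_product_def)
    show "h x \<in> carrier H"
      using uv by (simp add: h_class e_closed)
    show "h (x \<otimes>\<^bsub>amalgamated_product A B C f g\<^esub> y) = h x \<otimes>\<^bsub>H\<^esub> h y"
      using uv by (simp add: amalg_mult_class h_class e_append append_in_amalg_words)
  qed
  moreover have "h (amalg_inl A B C f g x) = p x" if "x \<in> carrier A" for x
  proof -
    have "p x \<in> carrier H" using that p by (auto simp: hom_def)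
    then show ?thesis
      using that h_class[of "[Inl x]"] by (simp add: amalg_inl_def amalg_words_def InlI InrI e_def)
  qed
  moreover have "h (amalg_inr A B C f g y) = q y" if "y \<in> carrier B" for y
  proof -
    have "q y \<in> carrier H" using that q by (auto simp: hom_def)
    then show ?thesis
      using that h_class[of "[Inr y]"] by (simp add: amalg_inr_def amalg_words_def InlI InrI e_def)
  qed
  ultimately show ?thesis by blast
qed

lemma amalg_universal_unique:
  fixes H :: "('d, 'l) monoid_scheme"
  assumes H: "group H"
    and h: "h \<in> hom (amalgamated_product A B C f g) H"
    and k: "k \<in> hom (amalgamated_product A B C f g) H"
    and l: "\<And>x. x \<in> carrier A \<Longrightarrow> h (amalg_inl A B C f g x) = k (amalg_inl A B C f g x)"
    and r: "\<And>y. y \<in> carrier B \<Longrightarrow> h (amalg_inr A B C f g y) = k (amalg_inr A B C f g y)"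
    and X: "X \<in> carrier (amalgamated_product A B C f g)"
  shows "h X = k X"
proof -
  let ?P = "amalgamated_product A B C f g"
  have "h (amalg_class A B C f g u) = k (amalg_class A B C f g u)" if "u \<in> amalg_words A B" for u
    using that
  proof (induction u)
    case Nil
    have "\<one>\<^bsub>?P\<^esub> = amalg_class A B C f g []"
      by (simp add: amalgamated_product_def)
    then show ?case
      using hom_one[OF h group_amalgamated_product H] hom_one[OF k group_amalgamated_product H]
      by simp
  next
    case (Cons x u)
    then have u: "u \<in> amalg_words A B" and x: "[x] \<in> amalg_words A B"
      by (simp_all add: amalg_words_def)
    have xu: "amalg_class A B C f g (x # u)
        = amalg_class A B C f g [x] \<otimes>\<^bsub>?P\<^esub> amalg_class A B C f g u"
      using amalg_mult_class[OF x u] by simp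
    have car: "amalg_class A B C f g [x] \<in> carrier ?P" "amalg_class A B C f g u \<in> carrier ?P"
      using u x by (simp_all add: amalgamated_product_def)
    have "h (amalg_class A B C f g [x]) = k (amalg_class A B C f g [x])"
      using x l r by (auto simp: amalg_words_def amalg_inl_def amalg_inr_def)
    then show ?case
      using Cons.IH[OF u] hom_mult[OF h car] hom_mult[OF k car] by (simp add: xu)
  qed
  then show ?thesis
    using X by (auto simp: amalgamated_product_def)
qed

end

end

theory Submission
  imports Defs "HOL-Algebra.Multiplicative_Group"
begin

text \<open>
  \<open>F\<close> has index 2 in both factors, so it is normal in \<open>G\<close>, and \<open>G / F\<close> is generated by two
  involutions, the classes of some \<open>a \<in> G\<^sub>1\<close> and \<open>b \<in> G\<^sub>2\<close>. Hence modulo \<open>F\<close> every element of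
  \<open>G\<close> is either a translation \<open>t\<^sup>n\<close> with \<open>t = a \<otimes> b\<close>, or a reflection \<open>t\<^sup>n \<otimes> a\<close>, which is conjugate
  to \<open>a\<close> or \<open>b\<close>. A reflection in the kernel has a conjugate in \<open>G\<^sub>1\<close> or \<open>G\<^sub>2\<close>, so it is
  trivial; a translation with \<open>n \<noteq> 0\<close> in the kernel would make the image of \<open>t\<close>, and hence the
  whole image, finite; and the elements of \<open>F\<close> are covered by injectivity on \<open>G\<^sub>1\<close>.
\<close>

section \<open>Index two and normality\<close>

lemma (in group) index_two_coset_reps:
  assumes F: "subgroup F G" and "card (rcosets F) = 2"
  obtains a where "a \<in> carrier G - F" "\<And>x. x \<in> carrier G - F \<Longrightarrow> F #> x = F #> a"
proof -
  obtain X Y where XY: "rcosets F = {X, Y}" "X \<noteq> Y"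
    using assms(2) card_2_iff by metis
  have F': "F \<in> rcosets F"
    using F by (rule subgroup.subgroup_in_rcosets[OF _ is_group])
  have neq: "F #> x \<noteq> F" if "x \<in> carrier G - F" for x
    using that rcos_self[OF _ F, of x] by auto
  define Z where "Z = (if X = F then Y else X)"
  \<comment> \<open>\<open>Z\<close> is the coset other than \<open>F\<close>. The membership
    premise concerns \<open>W\<close> alone; instantiating \<open>W\<close> with \<open>F\<close>
    frees the facts about \<open>Z\<close> from it.\<close>
  have Z: "Z \<in> rcosets F" "Z \<noteq> F" and all: "W = F \<or> W = Z" if "W \<in> rcosets F" for W
    using XY F' that unfolding Z_def by auto
  from Z(1)[OF F'] obtain a where a: "a \<in> carrier G" "Z = F #> a"
    unfolding RCOSETS_def by auto
  have "a \<notin> F"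
    using a Z(2)[OF F'] coset_join2[OF _ F] by auto
  moreover have "F #> x = F #> a" if "x \<in> carrier G - F" for x
    using all[of "F #> x"] neq[OF that] that a(2) by (auto simp: RCOSETS_def)
  ultimately show thesis using that a(1) by blast
qed

text \<open>Since \<open>inv y\<close> also lies outside \<open>F\<close>, it shares with
  \<open>x\<close> the only coset different from \<open>F\<close>.\<close>

lemma (in group) index_two_mult:
  assumes F: "subgroup F G" and "card (rcosets F) = 2"
    and x: "x \<in> carrier G - F" and y: "y \<in> carrier G - F"
  shows "x \<otimes> y \<in> F"
proof -
  obtain a where a: "\<And>z. z \<in> carrier G - F \<Longrightarrow> F #> z = F #> a"
    using index_two_coset_reps[OF assms(1,2)] by metis
  have "inv y \<in> carrier G - F"
    using y subgroup.m_inv_closed[OF F, of "inv y"] by auto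
  then have "F #> inv y = F #> x"
    using a x by simp
  then have "x \<in> F #> inv y"
    using rcos_self[OF _ F, of x] x by auto
  then show ?thesis
    using subgroup.rcos_module[OF F is_group, of "inv y" x] x y by simp
qed

text \<open>For \<open>x\<close> outside \<open>F\<close>, both \<open>x \<otimes> f\<close> and
  \<open>inv x\<close> are outside \<open>F\<close>, so their product falls into \<open>F\<close> by
  the preceding lemma.\<close>

lemma (in group) index_two_normal:
  assumes F: "subgroup F G" and "card (rcosets F) = 2"
  shows "F \<lhd> G"
  unfolding normal_inv_iff
proof (intro conjI F ballI)
  fix x f assume x: "x \<in> carrier G" and f: "f \<in> F"
  have fG: "f \<in> carrier G" using f subgroup.subset[OF F] by blast
  show "x \<otimes> f \<otimes> inv x \<in> F"
  proof (cases "x \<in> F")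
    case True
    then show ?thesis
      using F f by (simp add: subgroup.m_closed subgroup.m_inv_closed)
  next
    case False
    have "x \<otimes> f \<notin> F"
    proof
      assume "x \<otimes> f \<in> F"
      then have "x \<otimes> f \<otimes> inv f \<in> F"
        using F f by (simp add: subgroup.m_closed subgroup.m_inv_closed)
      then show False using False x fG by (simp add: m_assoc)
    qed
    moreover have "inv x \<notin> F"
      using False x subgroup.m_inv_closed[OF F, of "inv x"] by auto
    ultimately show ?thesis
      using index_two_mult[OF assms, of "x \<otimes> f" "inv x"] x fG by simp
  qed
qed

text \<open>Elements conjugating \<open>F\<close> into itself are closed under products, but for
  infinite \<open>F\<close> not always under inverses; hence both \<open>conj\<close> and
  \<open>conj_inv\<close>.\<close>

lemma (in group) generate_normalizes:
  assumes F: "subgroup F G" and S: "S \<subseteq> carrier G" "generate G S = carrier G"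
    and conj: "\<And>s f. s \<in> S \<Longrightarrow> f \<in> F \<Longrightarrow> s \<otimes> f \<otimes> inv s \<in> F"
    and conj_inv: "\<And>s f. s \<in> S \<Longrightarrow> f \<in> F \<Longrightarrow> inv s \<otimes> f \<otimes> s \<in> F"
  shows "F \<lhd> G"
proof -
  have FG: "f \<in> carrier G" if "f \<in> F" for f
    using that subgroup.subset[OF F] by blast
  have "\<forall>f\<in>F. x \<otimes> f \<otimes> inv x \<in> F" if "x \<in> generate G S" for x
    using that
  proof (induction rule: generate.induct)
    case one
    then show ?case using FG by simp
  next
    case (incl s)
    then show ?case using conj by simp
  next
    case (inv s)
    then have "s \<in> carrier G" using S by blast
    then show ?case using conj_inv[OF inv] by simp
  next
    case (eng x y)
    then have xy: "x \<in> carrier G" "y \<in> carrier G" using S by auto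
    have "x \<otimes> y \<otimes> f \<otimes> inv (x \<otimes> y) = x \<otimes> (y \<otimes> f \<otimes> inv y) \<otimes> inv x" if "f \<in> F" for f
      using xy FG[OF that] by (simp add: inv_mult_group m_assoc)
    then show ?case using eng.IH by simp
  qed
  then show ?thesis using F S by (simp add: normal_inv_iff)
qed

section \<open>Groups generated by two involutions\<close>

lemma (in group) involution_conj_pow:
  assumes a: "a \<in> carrier G" "a \<otimes> a = \<one>" and b: "b \<in> carrier G" "b \<otimes> b = \<one>"
  shows "a \<otimes> (a \<otimes> b) [^] (n::int) = (a \<otimes> b) [^] (- n) \<otimes> a"
proof -
  have inv: "inv a = a" "inv b = b"
    using a b by (auto intro: inv_equality)
  \<comment> \<open>As \<open>a\<close> is its own inverse, this is conjugation by \<open>a\<close>;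
    it inverts \<open>a \<otimes> b\<close> and therefore every power of it.\<close>
  have "(\<lambda>x. a \<otimes> x \<otimes> a) \<in> hom G G"
  proof (rule homI)
    fix x y assume xy: "x \<in> carrier G" "y \<in> carrier G"
    have "a \<otimes> x \<otimes> a \<otimes> (a \<otimes> y \<otimes> a) = a \<otimes> x \<otimes> (a \<otimes> a) \<otimes> y \<otimes> a"
      using a(1) xy by (simp only: m_assoc m_closed)
    then show "a \<otimes> (x \<otimes> y) \<otimes> a = a \<otimes> x \<otimes> a \<otimes> (a \<otimes> y \<otimes> a)"
      using a xy by (simp add: m_assoc)
  qed (use a in simp)
  then have "a \<otimes> (a \<otimes> b) [^] n \<otimes> a = (a \<otimes> (a \<otimes> b) \<otimes> a) [^] n"
    using hom_int_pow[OF _ _ is_group is_group, of "\<lambda>x. a \<otimes> x \<otimes> a" "a \<otimes> b" n] a b by simp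
  also have "a \<otimes> (a \<otimes> b) \<otimes> a = inv (a \<otimes> b)"
    using a b by (simp add: inv inv_mult_group flip: m_assoc)
  also have "\<dots> [^] n = (a \<otimes> b) [^] (- n)"
    using a b by (simp add: int_pow_inv int_pow_neg)
  finally have "a \<otimes> (a \<otimes> b) [^] n \<otimes> a \<otimes> a = (a \<otimes> b) [^] (- n) \<otimes> a" by simp
  then show ?thesis using a b by (simp add: m_assoc)
qed

text \<open>Makes \<open>b\<close> the reflection with exponent -1, beside \<open>a\<close> with
  exponent 0.\<close>

lemma (in group) involution_eq_pow:
  assumes a: "a \<in> carrier G" "a \<otimes> a = \<one>" and b: "b \<in> carrier G" "b \<otimes> b = \<one>"
  shows "b = (a \<otimes> b) [^] (-1::int) \<otimes> a"
proof -
  have inv: "inv a = a" "inv b = b"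
    using a b by (auto intro: inv_equality)
  have "(a \<otimes> b) [^] (-1::int) \<otimes> a = inv (a \<otimes> b) \<otimes> a"
    using int_pow_neg[of "a \<otimes> b" 1] a b by simp
  also have "\<dots> = b"
    using a b by (simp add: inv_mult_group inv m_assoc)
  finally show ?thesis by simp
qed

lemma (in group) generate_involutions:
  assumes a: "a \<in> carrier G" "a \<otimes> a = \<one>" and b: "b \<in> carrier G" "b \<otimes> b = \<one>"
    and x: "x \<in> generate G {a, b}"
  shows "\<exists>n::int. x = (a \<otimes> b) [^] n \<or> x = (a \<otimes> b) [^] n \<otimes> a"
proof -
  let ?t = "a \<otimes> b"
  have inv: "inv a = a" "inv b = b"
    using a b by (auto intro: inv_equality)
  have t: "?t \<in> carrier G" using a b by simp
  note b_eq = involution_eq_pow[OF a b]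
  have a_eq: "a = ?t [^] (0::int) \<otimes> a" using a by simp
  note flip = involution_conj_pow[OF a b]
  have flip': "a \<otimes> (?t [^] n \<otimes> y) = ?t [^] (- n) \<otimes> (a \<otimes> y)" if "y \<in> carrier G" for n :: int and y
    using flip[of n] a t that by (simp flip: m_assoc)
  have shift: "?t [^] m \<otimes> (?t [^] n \<otimes> y) = ?t [^] (m + n) \<otimes> y" if "y \<in> carrier G" for m n :: int and y
    using t that by (simp add: int_pow_mult m_assoc)
  show ?thesis using x
  proof (induction rule: generate.induct)
    case one
    show ?case by (metis int_pow_0)
  next
    case (incl s)
    then show ?case using a_eq b_eq by blast
  next
    case (inv s)
    then have "inv s = a \<or> inv s = b"
      using \<open>inv a = a\<close> \<open>inv b = b\<close> by auto
    then show ?case using a_eq b_eq by metis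
  next
    case (eng x y)
    then obtain m n :: int where
      "x = ?t [^] m \<or> x = ?t [^] m \<otimes> a" "y = ?t [^] n \<or> y = ?t [^] n \<otimes> a"
      by blast
    \<comment> \<open>A left factor without \<open>a\<close> adds the exponents; one ending in
      \<open>a\<close> negates the exponent of the right factor and toggles the trailing
      \<open>a\<close>.\<close>
    then have "x \<otimes> y = ?t [^] (m + n) \<or> x \<otimes> y = ?t [^] (m + n) \<otimes> a
        \<or> x \<otimes> y = ?t [^] (m - n) \<otimes> a \<or> x \<otimes> y = ?t [^] (m - n)"
      using a t flip[of n] flip'[of a n] shift[of a m n] shift[of a m "- n"]
      by (auto simp: m_assoc int_pow_mult[OF t, of m n] int_pow_mult[OF t, of m "- n", simplified])
    then show ?case by blast
  qed
qed

text \<open>Conjugating by the power \<open>m\<close> shifts the exponent by \<open>2 * m\<close>,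
  so only parity matters: even exponents reach 0, which gives \<open>a\<close>, odd ones reach -1,
  which gives \<open>b\<close>.\<close>

lemma (in group) reflection_conj_generator:
  assumes a: "a \<in> carrier G" "a \<otimes> a = \<one>" and b: "b \<in> carrier G" "b \<otimes> b = \<one>"
  obtains m :: int
    where "(a \<otimes> b) [^] m \<otimes> ((a \<otimes> b) [^] (n::int) \<otimes> a) \<otimes> inv ((a \<otimes> b) [^] m) \<in> {a, b}"
proof -
  let ?t = "a \<otimes> b"
  have t: "?t \<in> carrier G" using a b by simp
  have conj: "?t [^] m \<otimes> (?t [^] n \<otimes> a) \<otimes> inv (?t [^] m) = ?t [^] (n + 2 * m) \<otimes> a" for m :: int
  proof -
    have "?t [^] m \<otimes> (?t [^] n \<otimes> a) \<otimes> inv (?t [^] m) = ?t [^] (m + n) \<otimes> (a \<otimes> ?t [^] (- m))"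
      using a t by (simp add: int_pow_mult int_pow_neg m_assoc)
    also have "\<dots> = ?t [^] (m + n + m) \<otimes> a"
      unfolding int_pow_mult[OF t, of "m + n" m]
      using a t by (simp add: involution_conj_pow[OF a b] m_assoc)
    also have "m + n + m = n + 2 * m" by simp
    finally show ?thesis .
  qed
  note b_eq = involution_eq_pow[OF a b]
  have "n + 2 * (- (n div 2)) = 0 \<or> n + 2 * (- (n div 2) - 1) = -1" by presburger
  then have "\<exists>m. n + 2 * m = 0 \<or> n + 2 * m = -1" by blast
  then obtain m where "n + 2 * m = 0 \<or> n + 2 * m = -1" by blast
  then have "?t [^] (n + 2 * m) \<otimes> a \<in> {a, b}"
    using b_eq a by auto
  then show thesis using that conj by metis
qed

section \<open>Lifting the dihedral normal form from the quotient\<close>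

text \<open>Modulo \<open>H\<close> the classes of \<open>a\<close> and \<open>b\<close> are
  generators squaring to the unit, so the results on involutions apply and are pulled back. The
  cosets serve to bound an image, the conjugator \<open>g\<close> to treat a kernel element.\<close>

lemma (in normal) dihedral_quotient_cases:
  assumes a: "a \<in> carrier G" "a \<otimes> a \<in> H" and b: "b \<in> carrier G" "b \<otimes> b \<in> H"
    and gen: "generate G (insert a (insert b H)) = carrier G" and x: "x \<in> carrier G"
  obtains n :: int where "x \<in> H #> (a \<otimes> b) [^] n"
  | n :: int and g where "x \<in> H #> ((a \<otimes> b) [^] n \<otimes> a)"
      "g \<in> carrier G" "g \<otimes> x \<otimes> inv g \<in> (H #> a) \<union> (H #> b)"
proof -
  let ?\<pi> = "\<lambda>x. H #> x" and ?t = "a \<otimes> b"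
  interpret Q: group "G Mod H" by (rule factorgroup_is_group)
  interpret \<pi>: group_hom G "G Mod H" ?\<pi>
    using r_coset_hom_Mod by unfold_locales
  have one: "?\<pi> f = \<one>\<^bsub>G Mod H\<^esub>" if "f \<in> H" for f
    using that coset_join2[OF _ subgroup_axioms] subset by (auto simp: FactGroup_def)
  have t: "?t \<in> carrier G" using a b by simp
  have \<alpha>: "?\<pi> a \<in> carrier (G Mod H)" "?\<pi> a \<otimes>\<^bsub>G Mod H\<^esub> ?\<pi> a = \<one>\<^bsub>G Mod H\<^esub>"
    using a one[OF a(2)] \<pi>.hom_mult[OF a(1) a(1)] \<pi>.hom_closed[OF a(1)] by simp_all
  have \<beta>: "?\<pi> b \<in> carrier (G Mod H)" "?\<pi> b \<otimes>\<^bsub>G Mod H\<^esub> ?\<pi> b = \<one>\<^bsub>G Mod H\<^esub>"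
    using b one[OF b(2)] \<pi>.hom_mult[OF b(1) b(1)] \<pi>.hom_closed[OF b(1)] by simp_all
  have \<tau>: "(?\<pi> a \<otimes>\<^bsub>G Mod H\<^esub> ?\<pi> b) [^]\<^bsub>G Mod H\<^esub> n = ?\<pi> (?t [^] n)" for n :: int
    using FactGroup_int_pow[OF t, of n] \<pi>.hom_mult[OF a(1) b(1)] by simp
  have "?\<pi> x \<in> ?\<pi> ` generate G (insert a (insert b H))"
    using x gen by simp
  also have "\<dots> = generate (G Mod H) (?\<pi> ` insert a (insert b H))"
    using a b subset by (intro \<pi>.generate_img[symmetric]) auto
  \<comment> \<open>\<open>H\<close> collapses to the unit and so drops out of the
    generators.\<close>
  also have "\<dots> \<subseteq> generate (G Mod H) {?\<pi> a, ?\<pi> b}"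
  proof (rule Q.generate_subgroup_incl)
    show "subgroup (generate (G Mod H) {?\<pi> a, ?\<pi> b}) (G Mod H)"
      using \<alpha> \<beta> by (intro Q.generate_is_subgroup) auto
    show "?\<pi> ` insert a (insert b H) \<subseteq> generate (G Mod H) {?\<pi> a, ?\<pi> b}"
      using one generate.one[of "G Mod H" "{?\<pi> a, ?\<pi> b}"] by (auto intro: generate.incl)
  qed
  finally obtain n :: int where n: "?\<pi> x = ?\<pi> (?t [^] n)
      \<or> ?\<pi> x = ?\<pi> (?t [^] n) \<otimes>\<^bsub>G Mod H\<^esub> ?\<pi> a"
    using Q.generate_involutions[OF \<alpha> \<beta>] \<tau> by metis
  have mem: "y \<in> ?\<pi> z" if "?\<pi> y = ?\<pi> z" "y \<in> carrier G" for y z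
    using that rcos_self[OF _ subgroup_axioms] by metis
  show thesis
  proof (cases "?\<pi> x = ?\<pi> (?t [^] n)")
    case True
    then show thesis using that(1) mem x by blast
  next
    case False
    then have eq: "?\<pi> x = ?\<pi> (?t [^] n) \<otimes>\<^bsub>G Mod H\<^esub> ?\<pi> a" using n by blast
    then have "?\<pi> x = ?\<pi> (?t [^] n \<otimes> a)" using a t by simp
    then have x': "x \<in> ?\<pi> (?t [^] n \<otimes> a)" using mem x by blast
    obtain m :: int where m: "?\<pi> (?t [^] m) \<otimes>\<^bsub>G Mod H\<^esub> ?\<pi> x \<otimes>\<^bsub>G Mod H\<^esub>
        inv\<^bsub>G Mod H\<^esub> ?\<pi> (?t [^] m) \<in> {?\<pi> a, ?\<pi> b}"
      using Q.reflection_conj_generator[OF \<alpha> \<beta>, of n] unfolding \<tau> eq by metis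
    have "?\<pi> (?t [^] m \<otimes> x \<otimes> inv (?t [^] m)) \<in> {?\<pi> a, ?\<pi> b}"
      using m t x \<pi>.hom_inv[of "?t [^] m"] by simp
    then have "?t [^] m \<otimes> x \<otimes> inv (?t [^] m) \<in> ?\<pi> a \<union> ?\<pi> b"
      using mem t x by auto
    then show thesis using that(2)[OF x'] t by blast
  qed
qed

section \<open>Finite images and kernels\<close>

text \<open>A nonzero power of the translation \<open>t = a \<otimes> b\<close> that lands in the finite group \<open>h ` F\<close>
  gives \<open>h t\<close> finite order, and \<open>F\<close>, \<open>t\<close> and \<open>a\<close> already cover \<open>G\<close>.\<close>

lemma (in group_hom) dihedral_finite_image:
  assumes F: "F \<lhd> G" "finite F"
    and a: "a \<in> carrier G" "a \<otimes> a \<in> F" and b: "b \<in> carrier G" "b \<otimes> b \<in> F"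
    and gen: "generate G (insert a (insert b F)) = carrier G"
    and n: "(n::int) \<noteq> 0" "h ((a \<otimes> b) [^] n) \<in> h ` F"
  shows "finite (h ` carrier G)"
proof -
  interpret F: normal F G by (rule F(1))
  let ?t = "a \<otimes> b"
  have t: "?t \<in> carrier G" using a b by simp
  have hF: "subgroup (h ` F) H"
    by (rule subgroup_img_is_subgroup[OF F.subgroup_axioms])
  interpret K: group "H\<lparr>carrier := h ` F\<rparr>"
    using hF by (rule subgroup.subgroup_is_group) (rule H.is_group)
  \<comment> \<open>By Lagrange in the image of \<open>F\<close>; since that image is finite and
    nonempty, \<open>n\<close> times its order is a nonzero exponent killing
    \<open>h ?t\<close>.\<close>
  have "h (?t [^] n) [^]\<^bsub>H\<^esub> card (h ` F) = \<one>\<^bsub>H\<^esub>"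
    using K.pow_order_eq_1[of "h (?t [^] n)"] n(2) H.nat_pow_consistent[of "h (?t [^] n)" "card (h ` F)" "h ` F"]
    by (simp add: order_def)
  then have "h ?t [^]\<^bsub>H\<^esub> (n * int (card (h ` F))) = \<one>\<^bsub>H\<^esub>"
    using t hom_int_pow[OF t, of n] by (simp add: H.int_pow_pow[symmetric] int_pow_int)
  moreover have "card (h ` F) \<noteq> 0"
    using F(2) imageI[OF F.one_closed, of h] by (auto simp only: card_eq_0_iff finite_imageI)
  ultimately have "finite (carrier (subgroup_generated H {h ?t}))"
    using n(1) t by (subst H.finite_cyclic_subgroup_int) (auto intro!: exI[of _ "n * int (card (h ` F))"])
  then have P: "finite (range (\<lambda>k::int. h ?t [^]\<^bsub>H\<^esub> k))"
    using t by (simp add: H.carrier_subgroup_generated_by_singleton)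
  \<comment> \<open>The last factor is the unit for translations and \<open>h a\<close> for
    reflections; all three factors range over finite sets.\<close>
  let ?S = "(\<lambda>(f, p, c). f \<otimes>\<^bsub>H\<^esub> (p \<otimes>\<^bsub>H\<^esub> c)) `
    (h ` F \<times> range (\<lambda>k::int. h ?t [^]\<^bsub>H\<^esub> k) \<times> {\<one>\<^bsub>H\<^esub>, h a})"
  have "h x \<in> ?S" if x: "x \<in> carrier G" for x
  proof -
    have "\<exists>k::int. \<exists>c\<in>{\<one>, a}. x \<in> F #> (?t [^] k \<otimes> c)"
      using a b by (cases rule: F.dihedral_quotient_cases[OF a b gen x]) auto
    then obtain k :: int and c f where c: "c \<in> {\<one>, a}" and f: "f \<in> F"
      and x_eq: "x = f \<otimes> (?t [^] k \<otimes> c)"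
      unfolding r_coset_def by blast
    have "f \<in> carrier G" "c \<in> carrier G" using f c F.subset a by auto
    then have "h x = h f \<otimes>\<^bsub>H\<^esub> (h ?t [^]\<^bsub>H\<^esub> k \<otimes>\<^bsub>H\<^esub> h c)"
      unfolding x_eq using t hom_int_pow[OF t, of k] by (simp only: hom_mult G.m_closed G.int_pow_closed)
    moreover have "h c \<in> {\<one>\<^bsub>H\<^esub>, h a}" using c hom_one by blast
    ultimately show ?thesis
      using f by (intro image_eqI[of _ _ "(h f, h ?t [^]\<^bsub>H\<^esub> k, h c)"]) simp_all
  qed
  moreover have "finite ?S" using F(2) P by simp
  ultimately show ?thesis
    by (meson finite_subset image_subsetI)
qed

text \<open>The cosets in \<open>ker\<close> will make up the two factors, on which the homomorphism
  is injective.\<close>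

lemma (in group_hom) dihedral_inj_on:
  assumes F: "F \<lhd> G" "finite F"
    and a: "a \<in> carrier G" "a \<otimes> a \<in> F" and b: "b \<in> carrier G" "b \<otimes> b \<in> F"
    and gen: "generate G (insert a (insert b F)) = carrier G"
    and ker: "\<And>x. x \<in> F \<union> (F #> a) \<union> (F #> b) \<Longrightarrow> h x = \<one>\<^bsub>H\<^esub> \<Longrightarrow> x = \<one>"
    and inf: "infinite (h ` carrier G)"
  shows "inj_on h (carrier G)"
proof -
  interpret F: normal F G by (rule F(1))
  let ?t = "a \<otimes> b"
  have t: "?t \<in> carrier G" using a b by simp
  have "x = \<one>" if x: "x \<in> carrier G" "h x = \<one>\<^bsub>H\<^esub>" for x
  proof (cases rule: F.dihedral_quotient_cases[OF a b gen x(1)])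
    case (1 n)
    then obtain f where f: "f \<in> F" "x = f \<otimes> ?t [^] n"
      unfolding r_coset_def by blast
    have fG: "f \<in> carrier G" using f F.subset by blast
    \<comment> \<open>As \<open>h x\<close> is the unit, the power has the same image as
      \<open>inv f\<close>; a nonzero \<open>n\<close> would then make the whole image
      finite.\<close>
    have "?t [^] n = inv f \<otimes> x" using f(2) fG t x(1) by (simp only: G.inv_solve_left G.int_pow_closed)
    then have "h (?t [^] n) = h (inv f)" using x fG by simp
    then have "h (?t [^] n) \<in> h ` F" using imageI[OF F.m_inv_closed[OF f(1)], of h] by (simp only:)
    then have "n = 0"
      using dihedral_finite_image[OF F a b gen, of n] inf by blast
    then have "x \<in> F" using f fG by (simp only: int_pow_0 G.r_one)
    then show ?thesis using ker x by blast
  next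
    case (2 n g)
    have "h (g \<otimes> x \<otimes> inv g) = \<one>\<^bsub>H\<^esub>" using 2 x by simp
    then have "g \<otimes> x \<otimes> inv g = \<one>" using ker 2 by blast
    \<comment> \<open>\<open>g \<otimes> x\<close> is a left inverse of
      \<open>inv g\<close>.\<close>
    then have "g \<otimes> x = g" using G.inv_equality[of "g \<otimes> x" "inv g"] 2 x by simp
    then show ?thesis using 2 x by simp
  qed
  then show ?thesis
    using inj_on_one_iff by blast
qed

section \<open>Generators from the amalgam and its factors\<close>

text \<open>Every element of the amalgamated product is the class of a word, and
  \<open>\<psi>\<close> turns it into the product of its letters in \<open>G\<close>.\<close>

lemma is_amalgam_generate:
  assumes "is_amalgam G G1 G2 F"
  shows "generate G (G1 \<union> G2) = carrier G"
proof -
  let ?A = "G\<lparr>carrier := G1\<rparr>" and ?B = "G\<lparr>carrier := G2\<rparr>" and ?C = "G\<lparr>carrier := F\<rparr>"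
  let ?P = "amalgamated_product ?A ?B ?C id id" and ?N = "generate G (G1 \<union> G2)"
  have G: "group G" and G12: "subgroup G1 G" "subgroup G2 G" and F: "F \<subseteq> G1" "F \<subseteq> G2"
    using assms by (simp_all add: is_amalgam_def)
  obtain \<psi> where iso: "\<psi> \<in> iso ?P G"
    and inl: "\<And>x. x \<in> G1 \<Longrightarrow> \<psi> (amalg_inl ?A ?B ?C id id x) = x"
    and inr: "\<And>y. y \<in> G2 \<Longrightarrow> \<psi> (amalg_inr ?A ?B ?C id id y) = y"
    using assms by (auto simp: is_amalgam_def Let_def)
  interpret G: group G by (rule G)
  have A: "group ?A" and B: "group ?B"
    using G12 by (auto intro: subgroup.subgroup_is_group)
  have f: "id \<in> hom ?C ?A" and g: "id \<in> hom ?C ?B"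
    using F by (auto simp: hom_def)
  note cls = amalg_mult_class[OF A B f g]
  have sub: "G1 \<union> G2 \<subseteq> carrier G"
    using G12 by (auto dest: subgroup.subset)
  have hom: "\<psi> \<in> hom ?P G" and surj: "\<psi> ` carrier ?P = carrier G"
    using iso by (auto simp: iso_def bij_betw_def)
  have N: "\<psi> (amalg_class ?A ?B ?C id id u) \<in> ?N" if "u \<in> amalg_words ?A ?B" for u
    using that
  proof (induction u)
    case Nil
    have "amalg_class ?A ?B ?C id id [] = \<one>\<^bsub>?P\<^esub>"
      by (simp add: amalgamated_product_def)
    then have "\<psi> (amalg_class ?A ?B ?C id id []) = \<one>\<^bsub>G\<^esub>"
      using hom_one[OF hom group_amalgamated_product[OF A B f g] G] by (simp only:)
    then show ?case by (simp only: generate.one)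
  next
    case (Cons x u)
    then have u: "u \<in> amalg_words ?A ?B" and x: "[x] \<in> amalg_words ?A ?B"
      by (simp_all add: amalg_words_def)
    have car: "amalg_class ?A ?B ?C id id [x] \<in> carrier ?P" "amalg_class ?A ?B ?C id id u \<in> carrier ?P"
      using u x by (simp_all add: amalgamated_product_def)
    have "\<psi> (amalg_class ?A ?B ?C id id (x # u))
        = \<psi> (amalg_class ?A ?B ?C id id [x]) \<otimes>\<^bsub>G\<^esub> \<psi> (amalg_class ?A ?B ?C id id u)"
      using hom_mult[OF hom car] by (simp only: cls[OF x u] append.simps)
    moreover have "\<psi> (amalg_class ?A ?B ?C id id [x]) \<in> ?N"
      using x inl inr by (auto simp: amalg_words_def amalg_inl_def amalg_inr_def intro: generate.incl)
    ultimately show ?case using Cons.IH[OF u] by (simp only: generate.eng)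
  qed
  have "carrier G \<subseteq> ?N"
    unfolding surj[symmetric] using N by (auto simp: amalgamated_product_def)
  then show ?thesis using G.generate_in_carrier[OF sub] by blast
qed

text \<open>Supplies the representative that the dihedral lemmas ask for, phrased in the ambient
  group.\<close>

lemma (in group) index_two_subgroup_reps:
  assumes K: "subgroup K G" and F: "subgroup F G" "F \<subseteq> K"
    and idx: "card (rcosets\<^bsub>G\<lparr>carrier := K\<rparr>\<^esub> F) = 2"
  obtains a where "a \<in> carrier G" "a \<otimes> a \<in> F" "K = F \<union> (F #> a)"
proof -
  let ?K = "G\<lparr>carrier := K\<rparr>"
  interpret K: group ?K using K by (rule subgroup.subgroup_is_group) (rule is_group)
  have FK: "subgroup F ?K" using F K by (intro subgroup_incl)
  \<comment> \<open>Cosets depend only on the multiplication, so those formed in \<open>?K\<close>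
    and in \<open>G\<close> are the same sets.\<close>
  obtain a where a: "a \<in> K - F" and eq: "\<And>x. x \<in> K - F \<Longrightarrow> F #> x = F #> a"
    using K.index_two_coset_reps[OF FK idx] by (auto simp: r_coset_def)
  have aG: "a \<in> carrier G" using a subgroup.subset[OF K] by blast
  have "K \<subseteq> F \<union> (F #> a)"
  proof
    fix x assume "x \<in> K"
    then show "x \<in> F \<union> (F #> a)"
      using eq[of x] rcos_self[OF _ F(1), of x] subgroup.subset[OF K] by blast
  qed
  moreover have "F \<union> (F #> a) \<subseteq> K"
    using F a by (auto simp: r_coset_def subgroup.m_closed[OF K] subset_iff)
  moreover have "a \<otimes> a \<in> F"
    using K.index_two_mult[OF FK idx, of a a] a by simp
  ultimately show thesis using that aG by blast
qed

lemma (in group) index_two_subgroup_conj: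
  assumes K: "subgroup K G" and F: "subgroup F G" "F \<subseteq> K"
    and idx: "card (rcosets\<^bsub>G\<lparr>carrier := K\<rparr>\<^esub> F) = 2"
    and "x \<in> K" "f \<in> F"
  shows "x \<otimes> f \<otimes> inv x \<in> F"
proof -
  let ?K = "G\<lparr>carrier := K\<rparr>"
  interpret K: group ?K using K by (rule subgroup.subgroup_is_group) (rule is_group)
  have "F \<lhd> ?K"
    using F K by (intro K.index_two_normal subgroup_incl idx)
  then show ?thesis
    using assms by (auto simp: K.normal_inv_iff)
qed

section \<open>Injectivity on groups of Type II\<close>

theorem lemma16:
  fixes G :: "('a, 'm) monoid_scheme" and H :: "('b, 'n) monoid_scheme"
    and G1 G2 F :: "'a set" and \<phi> :: "'a \<Rightarrow> 'b"
  assumes "type_II G G1 G2 F"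
    and "group H"
    and "\<phi> \<in> hom G H"
    and "inj_on \<phi> G1"
    and "inj_on \<phi> G2"
  shows "inj_on \<phi> (carrier G) \<longleftrightarrow> infinite (\<phi> ` carrier G)"
proof
  assume "inj_on \<phi> (carrier G)"
  then show "infinite (\<phi> ` carrier G)"
    using assms(1) by (simp add: type_II_def finite_image_iff)
next
  assume inf: "infinite (\<phi> ` carrier G)"
  have am: "is_amalgam G G1 G2 F" and finF: "finite F"
    and idx: "card (rcosets\<^bsub>G\<lparr>carrier := G1\<rparr>\<^esub> F) = 2"
      "card (rcosets\<^bsub>G\<lparr>carrier := G2\<rparr>\<^esub> F) = 2"
    using assms(1) by (auto simp: type_II_def)
  have G: "group G" and G1: "subgroup G1 G" and G2: "subgroup G2 G"
    and F: "subgroup F G" "F \<subseteq> G1" "F \<subseteq> G2"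
    using am by (simp_all add: is_amalgam_def)
  interpret group_hom G H \<phi>
    using G assms(2,3) by (simp add: group_hom_def group_hom_axioms_def)
  have sub: "G1 \<union> G2 \<subseteq> carrier G"
    using G1 G2 by (auto dest: subgroup.subset)
  have gen: "generate G (G1 \<union> G2) = carrier G"
    using am by (rule is_amalgam_generate)
  have conj: "s \<otimes>\<^bsub>G\<^esub> f \<otimes>\<^bsub>G\<^esub> inv\<^bsub>G\<^esub> s \<in> F" if "s \<in> G1 \<union> G2" "f \<in> F" for s f
    using that G.index_two_subgroup_conj[OF G1 F(1,2) idx(1)]
      G.index_two_subgroup_conj[OF G2 F(1,3) idx(2)] by blast
  \<comment> \<open>\<open>F\<close> is normal in both factors, and these generate
    \<open>G\<close>.\<close>
  have normal: "F \<lhd> G"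
  proof (rule G.generate_normalizes[OF F(1) sub gen conj])
    fix s f assume s: "s \<in> G1 \<union> G2" and f: "f \<in> F"
    \<comment> \<open>Each factor is closed under inverses, so \<open>conj\<close> at the inverse of
      \<open>s\<close> yields the other conjugation condition.\<close>
    have "inv\<^bsub>G\<^esub> s \<in> G1 \<union> G2"
      using s G1 G2 by (auto dest: subgroup.m_inv_closed)
    then show "inv\<^bsub>G\<^esub> s \<otimes>\<^bsub>G\<^esub> f \<otimes>\<^bsub>G\<^esub> s \<in> F"
      using conj[of "inv\<^bsub>G\<^esub> s" f] f s sub by (auto simp: subset_iff)
  qed
  obtain a where a: "a \<in> carrier G" "a \<otimes>\<^bsub>G\<^esub> a \<in> F" "G1 = F \<union> (F #>\<^bsub>G\<^esub> a)"
    using G.index_two_subgroup_reps[OF G1 F(1,2) idx(1)] by blast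
  obtain b where b: "b \<in> carrier G" "b \<otimes>\<^bsub>G\<^esub> b \<in> F" "G2 = F \<union> (F #>\<^bsub>G\<^esub> b)"
    using G.index_two_subgroup_reps[OF G2 F(1,3) idx(2)] by blast
  have gen': "generate G (insert a (insert b F)) = carrier G"
  proof
    have S: "insert a (insert b F) \<subseteq> carrier G"
      using a b subgroup.subset[OF F(1)] by blast
    show "generate G (insert a (insert b F)) \<subseteq> carrier G"
      using G.generate_in_carrier[OF S] by blast
    have "G1 \<union> G2 \<subseteq> generate G (insert a (insert b F))"
      unfolding a(3) b(3) by (auto simp: r_coset_def intro: generate.intros)
    then show "carrier G \<subseteq> generate G (insert a (insert b F))"
      unfolding gen[symmetric] by (rule G.generate_subgroup_incl) (rule G.generate_is_subgroup[OF S])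
  qed
  \<comment> \<open>The unit lies in both factors, so injectivity on each makes the kernel meet it
    trivially.\<close>
  have "x = \<one>\<^bsub>G\<^esub>" if "x \<in> G1 \<union> G2" "\<phi> x = \<one>\<^bsub>H\<^esub>" for x
    using that inj_onD[OF assms(4), of x "\<one>\<^bsub>G\<^esub>"] inj_onD[OF assms(5), of x "\<one>\<^bsub>G\<^esub>"]
      subgroup.one_closed[OF G1] subgroup.one_closed[OF G2] hom_one by auto
  then show "inj_on \<phi> (carrier G)"
    using a(3) b(3) by (intro dihedral_inj_on[OF normal finF a(1,2) b(1,2) gen' _ inf]) auto
qed

end
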